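(* Let $\rho_0\in\mathcal S(\mathbb C^2)$, $\beta\in\mathcal S(\mathbb C^2)$, $\Gamma>0$, let $\mathsf H$ be a Hermitian operator on $\mathbb C^2\otimes\mathbb C^2$, and for $t\ge0$ set $\varepsilon_t[\rho]:=\mathbb E_0\big[e^{-\mathrm it\mathsf H}(\rho\otimes\beta)e^{\mathrm it\mathsf H}\big]$. For each $n\ge1$ let $(\rho_k(n))_{k\ge0}$ be the reduced states of the collision model with memory, with interaction time $\tau=1/n$ and memory parameter $p(n)=e^{-\Gamma/n}$, as described in the context. Then, as $n\to\infty$, the sequence $t\mapsto\rho_{\lfloor nt\rfloor}(n)$ converges in $L^\infty([0,1])$ to the deterministic path $\phi:[0,1]\to\mathcal S(\mathbb C^2)$ solving $$\phi_t=\Gamma\int_0^te^{-\Gamma(t-s)}\,\varepsilon_{t-s}[\phi_s]\,ds+e^{-\Gamma t}\,\varepsilon_t[\rho_0],\qquad t\in[0,1].$$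
   Context: $\mathcal S(\mathbb C^2)$ is the set of density matrices on $\mathbb C^2$. $\mathbb E_0$ denotes the partial trace onto the first (system) factor, i.e. tracing out all environment factors. Collision model with memory. The system space is $\mathcal H_0=\mathbb C^2$ and the environment is a chain of copies $\mathcal H_k=\mathbb C^2$, $k\ge1$. Let $\mathsf U=e^{-\mathrm i\tau\mathsf H}$ on $\mathcal H_0\otimes\mathbb C^2$, and let $\mathsf U_k$ act as $\mathsf U$ on $\mathcal H_0\otimes\mathcal H_k$ and as the identity on the other factors. Let $\widetilde{\mathsf S}_{k+1,k}$ be the unitary exchanging the factors $\mathcal H_k$ and $\mathcal H_{k+1}$, and for $p\in[0,1]$ let $\mathsf S_{k+1,k}[\sigma]=(1-p)\sigma+p\,\widetilde{\mathsf S}_{k+1,k}\,\sigma\,\widetilde{\mathsf S}_{k+1,k}$. Start from $\sigma_0=\rho_0\otimes\bigotimes_{j\ge1}\beta$, put $\sigma_1=\mathsf U_1\sigma_0\mathsf U_1^\dagger$ and $\sigma_{k+1}=\mathsf U_{k+1}\,\mathsf S_{k+1,k}[\sigma_k]\,\mathsf U_{k+1}^\dagger$ for $k\ge1$. The reduced states are $\rho_k=\mathbb E_0[\sigma_k]\in\mathcal S(\mathbb C^2)$. Equivalently (a known identity, which may be taken as the definition of $(\rho_k)$), for all $k\ge1$, $$\rho_k=(1-p)\sum_{j=1}^{k-1}p^{j-1}\,\mathbb E_0\big[\mathsf U^j(\rho_{k-j}\otimes\beta)(\mathsf U^\dagger)^j\big]+p^{k-1}\,\mathbb E_0\big[\mathsf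 U^k(\rho_0\otimes\beta)(\mathsf U^\dagger)^k\big].$$ With $\tau=1/n$ and $p=p(n)=e^{-\Gamma/n}$, the resulting sequence is denoted $(\rho_k(n))_{k\ge0}$. *)

theory Defs
  imports "HOL-Analysis.Analysis" "HOL-Probability.Essential_Supremum"
begin

text \<open>
  Operators on \<open>\<complex>\<^sup>2\<close> are matrices of type \<open>complex^2^2\<close>; operators on \<open>\<complex>\<^sup>2 \<otimes> \<complex>\<^sup>2\<close> are matrices
  whose rows and columns are indexed by pairs, the first component being the system index and
  the second the environment index. Products of operators are \<open>**\<close>; the class operation \<open>*\<close>
  on matrices is entrywise, so \<open>^\<close> and the library function \<open>exp\<close> are not the ones needed.
\<close>

type_synonym op_sys = "complex^2^2"
type_synonym op_joint = "complex^(2 \<times> 2)^(2 \<times> 2)"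

definition cscale :: "complex \<Rightarrow> complex^'m^'n \<Rightarrow> complex^'m^'n" where
  "cscale c A = map_matrix (\<lambda>z. c * z) A"

definition adjoint_mat :: "complex^'m^'n \<Rightarrow> complex^'n^'m" where
  "adjoint_mat A = map_matrix cnj (transpose A)"

definition hermitian :: "complex^'n^'n \<Rightarrow> bool" where
  "hermitian A \<longleftrightarrow> adjoint_mat A = A"

definition mpower :: "complex^'n^'n \<Rightarrow> nat \<Rightarrow> complex^'n^'n" where
  "mpower A k = (((**) A) ^^ k) (mat 1)"

definition mexp :: "complex^'n^'n \<Rightarrow> complex^'n^'n" where
  "mexp A = (\<Sum>k. (1 / fact k) *\<^sub>R mpower A k)"

definition tensor :: "complex^'a^'a \<Rightarrow> complex^'b^'b \<Rightarrow> complex^('a \<times> 'b)^('a \<times> 'b)" where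
  "tensor A B = (\<chi> i j. A $ fst i $ fst j * B $ snd i $ snd j)"

definition partial_trace :: "complex^('a \<times> 'b::finite)^('a \<times> 'b) \<Rightarrow> complex^'a^'a" where
  "partial_trace M = (\<chi> i j. \<Sum>k\<in>UNIV. M $ (i, k) $ (j, k))"

text \<open>For Hermitian \<open>A\<close> the quadratic form below is real, so taking \<open>Re\<close> loses nothing.\<close>

definition density_matrices :: "(complex^'n^'n) set" where
  "density_matrices = {A. hermitian A
     \<and> (\<forall>v. 0 \<le> Re (\<Sum>i\<in>UNIV. cnj (v $ i) * (A *v v) $ i))
     \<and> trace A = 1}"

definition evol :: "op_joint \<Rightarrow> op_sys \<Rightarrow> real \<Rightarrow> op_sys \<Rightarrow> op_sys" where
  "evol H \<beta> t \<rho> = partial_trace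
     (mexp (cscale (- \<i> * of_real t) H) ** tensor \<rho> \<beta> ** mexp (cscale (\<i> * of_real t) H))"

text \<open>
  \<open>reduced_state U \<beta> p \<rho>0 k\<close> is the reduced system state after \<open>k\<close> collisions, where each
  environment site starts in \<open>\<beta>\<close>, interacts with the system through \<open>U\<close>, and is exchanged with
  the next site with probability \<open>p\<close> before the next collision. The summand with index \<open>j\<close>
  collects the histories in which the site used in collision \<open>k\<close> has been carried along for
  exactly \<open>j\<close> collisions; the last term is the history without any reset.
\<close>

fun reduced_state :: "op_joint \<Rightarrow> op_sys \<Rightarrow> real \<Rightarrow> op_sys \<Rightarrow> nat \<Rightarrow> op_sys" where
  "reduced_state U \<beta> p \<rho>0 k = (if k = 0 then \<rho>0 else
     (1 - p) *\<^sub>R (\<Sum>j\<in>{1..k-1}. p ^ (j - 1) *\<^sub>R partial_trace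
        (mpower U j ** tensor (reduced_state U \<beta> p \<rho>0 (k - j)) \<beta> ** mpower (adjoint_mat U) j))
     + p ^ (k - 1) *\<^sub>R partial_trace
        (mpower U k ** tensor \<rho>0 \<beta> ** mpower (adjoint_mat U) k))"

declare reduced_state.simps [simp del]

text \<open>Interaction time \<open>1/n\<close> and memory parameter \<open>exp (-\<Gamma>/n)\<close>; meaningful for \<open>n \<ge> 1\<close>.\<close>

definition collision_state ::
    "op_joint \<Rightarrow> op_sys \<Rightarrow> real \<Rightarrow> op_sys \<Rightarrow> nat \<Rightarrow> nat \<Rightarrow> op_sys" where
  "collision_state H \<beta> \<Gamma> \<rho>0 n k = reduced_state
     (mexp (cscale (- \<i> * of_real (1 / real n)) H)) \<beta> (exp (- \<Gamma> / real n)) \<rho>0 k"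

text \<open>
  The integral is the gauge integral; on a bounded interval it agrees with the Lebesgue integral
  for integrands that are bounded, as is the case for \<open>\<phi>\<close> with values in density matrices.
\<close>

definition solves_memory_eq ::
    "op_joint \<Rightarrow> op_sys \<Rightarrow> real \<Rightarrow> op_sys \<Rightarrow> (real \<Rightarrow> op_sys) \<Rightarrow> bool" where
  "solves_memory_eq H \<beta> \<Gamma> \<rho>0 \<phi> \<longleftrightarrow> (\<forall>t\<in>{0..1}.
     (\<lambda>s. exp (- \<Gamma> * (t - s)) *\<^sub>R evol H \<beta> (t - s) (\<phi> s)) integrable_on {0..t} \<and>
     \<phi> t = \<Gamma> *\<^sub>R integral {0..t} (\<lambda>s. exp (- \<Gamma> * (t - s)) *\<^sub>R evol H \<beta> (t - s) (\<phi> s))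
           + exp (- \<Gamma> * t) *\<^sub>R evol H \<beta> t \<rho>0)"

definition Linfty_norm :: "'a measure \<Rightarrow> ('a \<Rightarrow> 'b::real_normed_vector) \<Rightarrow> ereal" where
  "Linfty_norm M f = esssup M (\<lambda>x. ereal (norm (f x)))"

definition in_Linfty :: "'a measure \<Rightarrow> ('a \<Rightarrow> 'b::real_normed_vector) \<Rightarrow> bool" where
  "in_Linfty M f \<longleftrightarrow> f \<in> borel_measurable M \<and> Linfty_norm M f < \<infinity>"

definition tendsto_Linfty ::
    "'a measure \<Rightarrow> (nat \<Rightarrow> 'a \<Rightarrow> 'b::real_normed_vector) \<Rightarrow> ('a \<Rightarrow> 'b) \<Rightarrow> bool" where
  "tendsto_Linfty M F g \<longleftrightarrow> (\<forall>n\<ge>1. in_Linfty M (F n)) \<and> in_Linfty M g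
     \<and> (\<lambda>n. Linfty_norm M (\<lambda>x. F n x - g x)) \<longlonglongrightarrow> 0"

end

theory Submission
  imports Defs
begin

text \<open>
  The theorem has an analytic half that knows nothing about quantum mechanics and an algebraic half
  that verifies its hypotheses.

  Analytic half (the locale \<open>memory_kernel\<close>). Let \<open>E t\<close> be a jointly continuous family of linear maps
  preserving a compact convex set \<open>S\<close>. The memory equation is a linear Volterra equation of the second
  kind with a bounded kernel, so Picard iteration converges uniformly on \<open>[0,1]\<close> with errors dominated
  by an exponential series, and the same factorial estimate gives uniqueness (\<open>picard_diff_bound\<close>).
  The right-hand side of the equation is an average: the weights \<open>\<Gamma> exp (-\<Gamma> (t - s)) ds\<close> on \<open>[0,t]\<close> and \<open>exp (-\<Gamma> t)\<close>
  add up to \<open>1\<close>. Hence all iterates, and the solution, stay in \<open>S\<close> (\<open>picard_in_S\<close>).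

  The recursion for the collision model is a quadrature rule for this very equation. With
  \<open>p = exp (-\<Gamma>/n)\<close>, the weight \<open>(1 - p) p ^ (k - i - 1)\<close> is exactly the integral of
  \<open>\<Gamma> exp (-\<Gamma> (k/n - s))\<close> over \<open>[i/n, (i+1)/n]\<close>. The only error is therefore the replacement of
  \<open>E\<close> and \<open>\<phi>\<close> on each cell by their values at its left end, which is small by uniform continuity
  (\<open>quadrature_error\<close>); a discrete Gronwall inequality carries this bound over to the difference of
  the recursion and the solution (\<open>scheme_error\<close>, \<open>scheme_converges\<close>).

  Algebraic half. Entry by entry, \<open>mexp (cscale z A)\<close> is an everywhere convergent power series in \<open>z\<close>.
  The Cauchy product yields the group law, so powers of the one-step unitary are again members of
  the group, and \<open>j\<close> collisions with the same site act exactly as \<open>evol\<close> at time \<open>j/n\<close>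
  (\<open>collision_state_rec\<close>). For Hermitian generators the group is unitary; as tensor products,
  conjugations and partial traces preserve positivity, \<open>evol\<close> maps density matrices to density
  matrices (\<open>evol_density\<close>).
\<close>

section \<open>Volterra equations with exponential memory\<close>

text \<open>
  In the application \<open>E t\<close> is the reduced evolution \<open>evol H \<beta> t\<close> and \<open>S\<close> the set of density matrices.
  The family need not be a semigroup, since tracing out the environment destroys the composition law.
\<close>

locale memory_kernel =
  fixes E :: "real \<Rightarrow> 'a \<Rightarrow> 'a::euclidean_space" and \<Gamma> :: real and S :: "'a set" and x0 :: 'a
  assumes linear_E: "linear (E t)"
    and continuous_E: "continuous_on UNIV (\<lambda>(t, x). E t x)"
    and E_x0: "E 0 x0 = x0"
    and \<Gamma>_pos: "\<Gamma> > 0"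
    and closed_S: "closed S" and convex_S: "convex S" and bounded_S: "bounded S"
    and x0_in_S: "x0 \<in> S"
    and E_in_S: "x \<in> S \<Longrightarrow> E t x \<in> S"
begin

definition kern :: "(real \<Rightarrow> 'a) \<Rightarrow> real \<Rightarrow> real \<Rightarrow> 'a" where
  "kern f t s = exp (- \<Gamma> * (t - s)) *\<^sub>R E (t - s) (f s)"

definition picard :: "(real \<Rightarrow> 'a) \<Rightarrow> real \<Rightarrow> 'a" where
  "picard f t = \<Gamma> *\<^sub>R integral {0..t} (kern f t) + exp (- \<Gamma> * t) *\<^sub>R E t x0"

definition solution :: "(real \<Rightarrow> 'a) \<Rightarrow> bool" where
  "solution f \<longleftrightarrow> (\<forall>t\<in>{0..1}. kern f t integrable_on {0..t} \<and> f t = picard f t)"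

lemma continuous_on_E [continuous_intros]:
  assumes "continuous_on A f" "continuous_on A g"
  shows "continuous_on A (\<lambda>z. E (f z) (g z))"
  using continuous_on_compose2[OF continuous_E continuous_on_Pair[OF assms]] by simp

lemma continuous_on_kern:
  assumes "continuous_on {0..1} f"
  shows "continuous_on ({0..1} \<times> {0..1}) (\<lambda>(t, s). kern f t s)"
proof -
  have "continuous_on ({0..1} \<times> {0..1}) (\<lambda>z::real\<times>real. f (snd z))"
    by (rule continuous_on_compose2[OF assms]) (auto intro!: continuous_intros)
  then show ?thesis
    unfolding kern_def case_prod_unfold by (intro continuous_intros)
qed

lemma kern_integrable:
  assumes "continuous_on {0..1} f" "0 \<le> a" "b \<le> 1" "t \<in> {0..1}"
  shows "kern f t integrable_on {a..b}"
proof (rule integrable_continuous_interval)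
  have "continuous_on {a..b} (\<lambda>s. (t, s))"
    by (intro continuous_intros)
  from continuous_on_compose2[OF continuous_on_kern[OF assms(1)] this]
  show "continuous_on {a..b} (kern f t)"
    using assms by force
qed

text \<open>
  Some uniform bound for the operator norms of \<open>E t\<close> on \<open>[0,1]\<close>; it is the Lipschitz constant in all
  estimates below.
\<close>

definition op_bound :: real where
  "op_bound = (SOME C. C > 0 \<and> (\<forall>t\<in>{0..1}. \<forall>x. norm (E t x) \<le> C * norm x))"

text \<open>
  By linearity it suffices to bound \<open>E t x\<close> on the compact set of all \<open>t\<close> in \<open>[0,1]\<close> and unit vectors \<open>x\<close>.
\<close>

lemma op_bound: "op_bound > 0" "t \<in> {0..1} \<Longrightarrow> norm (E t x) \<le> op_bound * norm x"
proof -
  have "compact ((\<lambda>z. E (fst z) (snd z)) ` ({0..1} \<times> sphere 0 1))"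
    by (intro compact_continuous_image continuous_intros compact_Times) auto
  then obtain C where C: "C > 0" "\<And>t x. t \<in> {0..1} \<Longrightarrow> norm x = 1 \<Longrightarrow> norm (E t x) \<le> C"
    unfolding compact_eq_bounded_closed bounded_pos by fastforce
  have "norm (E t x) \<le> C * norm x" if t: "t \<in> {0..1}" for t x
  proof (cases "x = 0")
    case True
    then show ?thesis using linear_0[OF linear_E] by simp
  next
    case False
    have "E t x = norm x *\<^sub>R E t (x /\<^sub>R norm x)"
      using False by (simp flip: linear_cmul[OF linear_E])
    also have "norm \<dots> \<le> norm x * C"
      using C(2)[OF t, of "x /\<^sub>R norm x"] False by (simp add: mult_left_mono)
    finally show ?thesis by (simp add: mult.commute)
  qed
  with C have "\<exists>C. C > 0 \<and> (\<forall>t\<in>{0..1}. \<forall>x. norm (E t x) \<le> C * norm x)" by blast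
  from someI_ex[OF this] show "op_bound > 0" "t \<in> {0..1} \<Longrightarrow> norm (E t x) \<le> op_bound * norm x"
    unfolding op_bound_def by blast+
qed

lemma kern_diff_bound:
  assumes "0 \<le> s" "s \<le> t" "t \<le> 1"
  shows "norm (kern f t s - kern g t s) \<le> op_bound * norm (f s - g s)"
proof -
  have "kern f t s - kern g t s = exp (- \<Gamma> * (t - s)) *\<^sub>R E (t - s) (f s - g s)"
    by (simp add: kern_def linear_diff[OF linear_E] scaleR_diff_right)
  also have "norm \<dots> \<le> 1 * norm (E (t - s) (f s - g s))"
    using mult_right_mono[of "exp (- \<Gamma> * (t - s))" 1 "norm (E (t - s) (f s - g s))"] assms \<Gamma>_pos
    by simp
  also have "\<dots> \<le> op_bound * norm (f s - g s)"
    using op_bound(2)[of "t - s"] assms by simp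
  finally show ?thesis .
qed

text \<open>
  The substitution \<open>s = t r\<close> turns the integral over \<open>[0,t]\<close> into one over the fixed interval \<open>[0,1]\<close>
  with \<open>t\<close> as a parameter, where continuity in the parameter is standard.
\<close>

lemma continuous_on_picard:
  assumes f: "continuous_on {0..1} f"
  shows "continuous_on {0..1} (picard f)"
proof -
  have resc: "integral {0..t} (kern f t) = t *\<^sub>R integral {0..1} (\<lambda>r. kern f t (t * r))"
    if t: "t \<in> {0..1}" for t
  proof (cases "t = 0")
    case False
    have "(kern f t has_integral integral {0..t} (kern f t)) {0..t}"
      using t by (intro integrable_integral kern_integrable f) auto
    from has_integral_affinity[OF this[folded cbox_interval], of t 0]
    have "((\<lambda>r. kern f t (t * r)) has_integral (1 / t) *\<^sub>R integral {0..t} (kern f t)) {0..1}"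
      using t False by (simp add: image_mult_atLeastAtMost_if)
    then show ?thesis using False by (simp add: integral_unique)
  qed auto
  have "continuous_on ({0..1} \<times> cbox 0 1) (\<lambda>z::real\<times>real. (fst z, fst z * snd z))"
    by (intro continuous_intros)
  from continuous_on_compose2[OF continuous_on_kern[OF f] this]
  have "continuous_on ({0..1} \<times> cbox 0 1) (\<lambda>(t, r). kern f t (t * r))"
    by (force simp: case_prod_unfold mult_le_one)
  from integral_continuous_on_param[OF this]
  have "continuous_on {0..1} (\<lambda>t. \<Gamma> *\<^sub>R t *\<^sub>R integral {0..1} (\<lambda>r. kern f t (t * r))
      + exp (- \<Gamma> * t) *\<^sub>R E t x0)"
    by (intro continuous_intros) (simp_all add: cbox_interval)
  then show ?thesis
    by (subst continuous_on_cong[OF refl]) (auto simp: picard_def resc)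
qed

text \<open>
  The estimate that drives Picard iteration: each application of the operator gains one power of \<open>t\<close>
  and one factor of the factorial. Only integrability of the kernels is assumed, so that the lemma also applies
  to solutions that are not known to be continuous.
\<close>

lemma picard_diff_bound:
  assumes f: "\<And>t. t \<in> {0..1} \<Longrightarrow> kern f t integrable_on {0..t}"
    and g: "\<And>t. t \<in> {0..1} \<Longrightarrow> kern g t integrable_on {0..t}"
    and fg: "\<And>s. s \<in> {0..1} \<Longrightarrow> norm (f s - g s) \<le> D * (op_bound * \<Gamma> * s) ^ m / fact m"
    and t: "t \<in> {0..1}"
  shows "norm (picard f t - picard g t) \<le> D * (op_bound * \<Gamma> * t) ^ Suc m / fact (Suc m)"
proof -
  let ?F = "\<lambda>s. D * (op_bound * \<Gamma> * s) ^ Suc m / fact (Suc m) / \<Gamma>"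
  have "((\<lambda>s. op_bound * (D * (op_bound * \<Gamma> * s) ^ m / fact m)) has_integral ?F t - ?F 0) {0..t}"
  proof (rule fundamental_theorem_of_calculus)
    fix s assume "s \<in> {0..t}"
    have "((\<lambda>s. (op_bound * \<Gamma> * s) ^ Suc m) has_real_derivative
        real (Suc m) * (op_bound * \<Gamma> * s) ^ m * (op_bound * \<Gamma>)) (at s within {0..t})"
      by (auto intro!: derivative_eq_intros simp del: power_Suc)
    from DERIV_cdivide[OF DERIV_cdivide[OF DERIV_cmult[OF this]]]
    have "(?F has_real_derivative
       D * (real (Suc m) * (op_bound * \<Gamma> * s) ^ m * (op_bound * \<Gamma>)) / fact (Suc m) / \<Gamma>) (at s within {0..t})"
      by blast
    also have "D * (real (Suc m) * (op_bound * \<Gamma> * s) ^ m * (op_bound * \<Gamma>)) / fact (Suc m) / \<Gamma>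
        = op_bound * (D * (op_bound * \<Gamma> * s) ^ m / fact m)"
      using \<Gamma>_pos by (simp add: field_simps del: of_nat_Suc)
    finally show "(?F has_vector_derivative op_bound * (D * (op_bound * \<Gamma> * s) ^ m / fact m)) (at s within {0..t})"
      by (simp add: has_real_derivative_iff_has_vector_derivative)
  qed (use t in auto)
  then have I: "((\<lambda>s. op_bound * (D * (op_bound * \<Gamma> * s) ^ m / fact m)) has_integral ?F t) {0..t}"
    by simp
  have "picard f t - picard g t = \<Gamma> *\<^sub>R integral {0..t} (\<lambda>s. kern f t s - kern g t s)"
    unfolding picard_def by (subst integral_diff[OF f[OF t] g[OF t]]) (simp add: scaleR_diff_right)
  also have "norm \<dots> = \<Gamma> * norm (integral {0..t} (\<lambda>s. kern f t s - kern g t s))"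
    using \<Gamma>_pos by simp
  also have "\<dots> \<le> \<Gamma> * integral {0..t} (\<lambda>s. op_bound * (D * (op_bound * \<Gamma> * s) ^ m / fact m))"
  proof (intro mult_left_mono integral_norm_bound_integral integrable_diff f[OF t] g[OF t])
    show "(\<lambda>s. op_bound * (D * (op_bound * \<Gamma> * s) ^ m / fact m)) integrable_on {0..t}"
      using I by blast
    fix s assume s: "s \<in> {0..t}"
    have "norm (kern f t s - kern g t s) \<le> op_bound * norm (f s - g s)"
      using s t by (intro kern_diff_bound) auto
    also have "\<dots> \<le> op_bound * (D * (op_bound * \<Gamma> * s) ^ m / fact m)"
      using s t op_bound(1) by (intro mult_left_mono fg) auto
    finally show "norm (kern f t s - kern g t s) \<le> op_bound * (D * (op_bound * \<Gamma> * s) ^ m / fact m)" .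
  qed (use \<Gamma>_pos in auto)
  also have "\<dots> = D * (op_bound * \<Gamma> * t) ^ Suc m / fact (Suc m)"
    unfolding integral_unique[OF I] using \<Gamma>_pos by simp
  finally show ?thesis .
qed

lemma weight_has_integral:
  assumes "a \<le> b"
  shows "((\<lambda>s. \<Gamma> * exp (- \<Gamma> * (t - s))) has_integral exp (- \<Gamma> * (t - b)) - exp (- \<Gamma> * (t - a))) {a..b}"
  using assms
  by (intro fundamental_theorem_of_calculus)
     (auto intro!: derivative_eq_intros simp flip: has_real_derivative_iff_has_vector_derivative)

text \<open>
  Since the weights in the Picard operator add up to \<open>1\<close>, its values are averages of points of \<open>S\<close>. A
  value outside the closed convex set \<open>S\<close> could be separated from it by a hyperplane, but a linear functional
  that exceeds \<open>b\<close> on \<open>S\<close> also has average at least \<open>b\<close>.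
\<close>

lemma picard_in_S:
  assumes f: "continuous_on {0..1} f" and fS: "\<And>t. t \<in> {0..1} \<Longrightarrow> f t \<in> S" and t: "t \<in> {0..1}"
  shows "picard f t \<in> S"
proof (rule ccontr)
  assume "picard f t \<notin> S"
  with separating_hyperplane_closed_point[OF convex_S closed_S]
  obtain a b where ab: "a \<bullet> picard f t < b" "\<And>x. x \<in> S \<Longrightarrow> b < a \<bullet> x" by metis
  have int: "kern f t integrable_on {0..t}"
    using t by (intro kern_integrable f) auto
  have "((\<lambda>s. a \<bullet> (\<Gamma> *\<^sub>R kern f t s)) has_integral a \<bullet> (\<Gamma> *\<^sub>R integral {0..t} (kern f t))) {0..t}"
    using has_integral_linear[OF has_integral_cmul[OF integrable_integral[OF int], of \<Gamma>]
        bounded_linear_inner_right[of a]] by (simp add: o_def)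
  moreover have "((\<lambda>s. \<Gamma> * exp (- \<Gamma> * (t - s)) * b) has_integral (1 - exp (- \<Gamma> * t)) * b) {0..t}"
    using has_integral_mult_left[OF weight_has_integral[of 0 t t], of b] t by simp
  moreover have "\<Gamma> * exp (- \<Gamma> * (t - s)) * b \<le> a \<bullet> (\<Gamma> *\<^sub>R kern f t s)" if s: "s \<in> {0..t}" for s
  proof -
    have "b \<le> a \<bullet> E (t - s) (f s)"
      using s t by (intro less_imp_le ab(2) E_in_S fS) auto
    then show ?thesis
      using \<Gamma>_pos by (simp add: kern_def mult.assoc)
  qed
  ultimately have "(1 - exp (- \<Gamma> * t)) * b \<le> a \<bullet> (\<Gamma> *\<^sub>R integral {0..t} (kern f t))"
    using has_integral_le by blast
  moreover have "exp (- \<Gamma> * t) * b \<le> a \<bullet> (exp (- \<Gamma> * t) *\<^sub>R E t x0)"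
    using ab(2)[OF E_in_S[OF x0_in_S], of t] by simp
  ultimately have "b \<le> a \<bullet> picard f t"
    by (simp only: picard_def inner_add_right left_diff_distrib)
  with ab show False by simp
qed

text \<open>
  The difference of two \<open>S\<close>-valued solutions is bounded and reproduced by the Picard operator, hence it is
  below every term of a sequence that tends to \<open>0\<close>.
\<close>

lemma solution_unique:
  assumes "solution f" "solution g" and fS: "\<And>t. t \<in> {0..1} \<Longrightarrow> f t \<in> S"
    and gS: "\<And>t. t \<in> {0..1} \<Longrightarrow> g t \<in> S" and t: "t \<in> {0..1}"
  shows "f t = g t"
proof -
  obtain B where B: "\<And>x. x \<in> S \<Longrightarrow> norm x \<le> B"
    using bounded_S unfolding bounded_iff by blast
  have *: "norm (f s - g s) \<le> 2 * B * (op_bound * \<Gamma> * s) ^ m / fact m" if "s \<in> {0..1}" for s m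
    using that
  proof (induction m arbitrary: s)
    case 0
    then show ?case
      using B[OF fS[OF 0]] B[OF gS[OF 0]] norm_triangle_ineq4[of "f s" "g s"] by simp
  next
    case (Suc m)
    have "norm (picard f s - picard g s) \<le> 2 * B * (op_bound * \<Gamma> * s) ^ Suc m / fact (Suc m)"
      by (rule picard_diff_bound) (use assms Suc in \<open>auto simp: solution_def\<close>)
    then show ?case
      using assms(1,2) Suc.prems unfolding solution_def by metis
  qed
  have "(\<lambda>m. 2 * B * ((op_bound * \<Gamma> * t) ^ m / fact m)) \<longlonglongrightarrow> 2 * B * 0"
    using summable_LIMSEQ_zero[OF summable_exp[of "op_bound * \<Gamma> * t"]]
    by (intro tendsto_intros) (simp add: field_simps)
  then have "norm (f t - g t) \<le> 0"
    by (intro LIMSEQ_le_const) (use *[OF t] in auto)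
  then show ?thesis by simp
qed

text \<open>
  The solution is the uniform limit of the Picard iterates of the constant path \<open>x0\<close>.
\<close>

lemma solution_exists:
  obtains f where "solution f" "continuous_on {0..1} f" "\<And>t. t \<in> {0..1} \<Longrightarrow> f t \<in> S"
proof -
  define F where "F m = (picard ^^ m) (\<lambda>_. x0)" for m
  have F_Suc: "F (Suc m) = picard (F m)" for m
    by (simp add: F_def)
  have contF: "continuous_on {0..1} (F m)" for m
    by (induction m) (auto simp: F_Suc continuous_on_picard, simp add: F_def)
  have FS: "F m t \<in> S" if "t \<in> {0..1}" for m t
    using that by (induction m arbitrary: t) (auto simp: F_Suc intro!: picard_in_S contF, simp add: F_def x0_in_S)
  obtain B where B: "\<And>x. x \<in> S \<Longrightarrow> norm x \<le> B"
    using bounded_S unfolding bounded_iff by blast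
  have step: "norm (F (Suc m) t - F m t) \<le> 2 * B * (op_bound * \<Gamma> * t) ^ m / fact m" if "t \<in> {0..1}" for m t
    using that
  proof (induction m arbitrary: t)
    case 0
    then show ?case
      using B[OF FS[OF 0]] norm_triangle_ineq4[of "F 1 t" "F 0 t"]
      by (smt (verit) One_nat_def div_by_1 fact_0 mult_cancel_left1 power_0)
  next
    case (Suc m)
    show ?case
      unfolding F_Suc[of "Suc m"] F_Suc[of m]
      by (rule picard_diff_bound) (use Suc in \<open>auto simp flip: F_Suc intro!: kern_integrable contF\<close>)
  qed
  have "uniform_limit {0..1} (\<lambda>n t. \<Sum>m<n. F (Suc m) t - F m t) (\<lambda>t. \<Sum>m. F (Suc m) t - F m t) sequentially"
  proof (rule Weierstrass_m_test)
    have B0: "0 \<le> B" using B[OF x0_in_S] norm_ge_zero[of x0] by linarith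
    show "norm (F (Suc m) t - F m t) \<le> 2 * B * ((op_bound * \<Gamma>) ^ m / fact m)" if "t \<in> {0..1}" for m t
    proof -
      have "norm (F (Suc m) t - F m t) \<le> 2 * B * ((op_bound * \<Gamma> * t) ^ m / fact m)"
        using step[OF that] by simp
      also have "\<dots> \<le> 2 * B * ((op_bound * \<Gamma>) ^ m / fact m)"
        using that op_bound(1) \<Gamma>_pos B0
        by (intro mult_left_mono divide_right_mono power_mono) (auto simp: mult_le_cancel_left1)
      finally show ?thesis .
    qed
    show "summable (\<lambda>m. 2 * B * ((op_bound * \<Gamma>) ^ m / fact m))"
      using summable_exp[of "op_bound * \<Gamma>"] by (intro summable_mult) (simp add: field_simps)
  qed
  then have "uniform_limit {0..1} (\<lambda>n t. F n t - x0) (\<lambda>t. \<Sum>m. F (Suc m) t - F m t) sequentially"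
    unfolding sum_lessThan_telescope[of "\<lambda>m. F m t" for t] by (simp add: F_def)
  from uniform_limit_add[OF this uniform_limit_const, of "\<lambda>_. x0"]
  obtain f where lim: "uniform_limit {0..1} F f sequentially" by auto
  have contf: "continuous_on {0..1} f"
    by (rule uniform_limit_theorem[OF _ lim]) (auto simp: contF)
  have ptw: "(\<lambda>m. F m t) \<longlonglongrightarrow> f t" if "t \<in> {0..1}" for t
    using tendsto_uniform_limitI[OF lim that] .
  have fS: "f t \<in> S" if "t \<in> {0..1}" for t
    using closed_sequentially[OF closed_S _ ptw[OF that]] FS[OF that] by blast
  have "f t = picard f t" if t: "t \<in> {0..1}" for t
  proof -
    have "(\<lambda>m. F (Suc m) t) \<longlonglongrightarrow> picard f t"
    proof (rule LIMSEQ_I)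
      fix e :: real assume e: "0 < e"
      define d where "d = e / (op_bound * \<Gamma> + 1)"
      have d: "0 < d" "d * (op_bound * \<Gamma>) < e"
        using e op_bound(1) \<Gamma>_pos by (auto simp: d_def field_simps add_pos_pos)
      obtain N where N: "\<And>m s. m \<ge> N \<Longrightarrow> s \<in> {0..1} \<Longrightarrow> dist (F m s) (f s) < d"
        using lim d(1) unfolding uniform_limit_sequentially_iff by blast
      have "norm (F (Suc m) t - picard f t) < e" if m: "m \<ge> N" for m
      proof -
        have "norm (picard (F m) t - picard f t) \<le> d * (op_bound * \<Gamma> * t) ^ Suc 0 / fact (Suc 0)"
          by (rule picard_diff_bound)
             (use t N[OF m] in \<open>auto simp: dist_norm less_imp_le intro!: kern_integrable contF contf\<close>)
        also have "\<dots> \<le> d * (op_bound * \<Gamma>)"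
          using t d(1) op_bound(1) \<Gamma>_pos by (auto simp: mult_le_cancel_left1)
        finally show ?thesis using d(2) by (simp add: F_Suc)
      qed
      then show "\<exists>N. \<forall>m\<ge>N. norm (F (Suc m) t - picard f t) < e" by blast
    qed
    with LIMSEQ_Suc[OF ptw[OF t]] show ?thesis
      using LIMSEQ_unique by blast
  qed
  then have "solution f"
    by (auto simp: solution_def intro!: kern_integrable contf)
  with contf fS show ?thesis using that by blast
qed

section \<open>Convergence of the quadrature scheme\<close>

lemma has_integral_sum_pieces:
  fixes g :: "real \<Rightarrow> 'b::banach"
  assumes "0 \<le> h" "\<And>i. i < k \<Longrightarrow> (g has_integral I i) {real i * h..real (Suc i) * h}"
  shows "(g has_integral (\<Sum>i<k. I i)) {0..real k * h}"
  using assms(2)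
proof (induction k)
  case (Suc k)
  have "(g has_integral (\<Sum>i<k. I i) + I k) {0..real (Suc k) * h}"
    by (rule has_integral_combine[of 0 "real k * h"])
       (use assms(1) Suc in \<open>auto intro!: mult_right_mono\<close>)
  then show ?case by simp
qed auto

lemma discrete_gronwall:
  fixes e :: "nat \<Rightarrow> real"
  assumes "0 \<le> q" "\<And>k. k \<le> n \<Longrightarrow> e k \<le> c + q * (\<Sum>i<k. e i)" "k \<le> n"
  shows "e k \<le> c * (1 + q) ^ k"
  using assms(3)
proof (induction k rule: less_induct)
  case (less k)
  have geo: "c + q * (\<Sum>i<k. c * (1 + q) ^ i) = c * (1 + q) ^ k"
    by (induction k) (auto simp: algebra_simps)
  have "e k \<le> c + q * (\<Sum>i<k. e i)"
    using assms(2) less by blast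
  also have "\<dots> \<le> c + q * (\<Sum>i<k. c * (1 + q) ^ i)"
    using less assms(1) by (intro add_left_mono mult_left_mono sum_mono) auto
  finally show ?case using geo by simp
qed

text \<open>
  Consistency: the solution satisfies the recursion up to the modulus of continuity of the integrand. The weights of
  the scheme are the exact integrals of the exponential weight over the cells, so no error comes from them, and
  they add up to \<open>1 - p ^ k\<close>, so the errors of the cells do not accumulate.
\<close>

lemma quadrature_error:
  fixes n k :: nat
  defines "p \<equiv> exp (- \<Gamma> / n)"
  assumes f: "solution f" "continuous_on {0..1} f" and n: "n \<ge> 1" and k: "k \<le> n"
    and unif: "\<And>s s'. s \<in> {0..k/n} \<Longrightarrow> s' \<in> {0..k/n} \<Longrightarrow> \<bar>s - s'\<bar> \<le> 1/n
       \<Longrightarrow> norm (E (k/n - s) (f s) - E (k/n - s') (f s')) \<le> \<epsilon>"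
  shows "norm (((1 - p) *\<^sub>R (\<Sum>i<k. p ^ (k - Suc i) *\<^sub>R E (real (k - i) / n) (f (i/n)))
      + p ^ k *\<^sub>R E (k/n) x0) - f (k/n)) \<le> \<epsilon>"
proof -
  let ?t = "real k / n" and ?h = "1 / real n"
  let ?w = "\<lambda>s. \<Gamma> * exp (- \<Gamma> * (?t - s))"
  have t: "?t \<in> {0..1}" using n k by auto
  have p_pow: "p ^ j = exp (- \<Gamma> * (j / n))" for j
    by (simp add: p_def flip: exp_of_nat_mult)
  have piece_sub: "s \<in> {0..?t}" if "s \<in> {real i * ?h..real (Suc i) * ?h}" "i < k" for s i
  proof -
    have "real (Suc i) * ?h \<le> real k * ?h" using that by (intro mult_right_mono) auto
    then show ?thesis using that by (auto intro: order_trans[of 0 "real i * ?h"])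
  qed
  have weight: "(?w has_integral (1 - p) * p ^ (k - Suc i)) {real i * ?h..real (Suc i) * ?h}"
    if "i < k" for i
  proof -
    have 1: "?t - real (Suc i) * ?h = real (k - Suc i) / n"
      using that by (simp add: of_nat_diff diff_divide_distrib)
    have 2: "?t - real i * ?h = real (k - i) / n"
      using that by (simp add: of_nat_diff diff_divide_distrib)
    have "k - i = Suc (k - Suc i)" using that by simp
    then have "exp (- \<Gamma> * (?t - real (Suc i) * ?h)) - exp (- \<Gamma> * (?t - real i * ?h))
        = (1 - p) * p ^ (k - Suc i)"
      unfolding 1 2 p_pow[symmetric] by (simp add: algebra_simps)
    then show ?thesis
      using weight_has_integral[of "real i * ?h" "real (Suc i) * ?h" ?t] n
      by (simp add: mult_right_mono divide_right_mono)
  qed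
  define y where "y i = E (real (k - i) / n) (f (i/n))" for i
  have y: "y i = E (?t - real i * ?h) (f (real i * ?h))" if "i < k" for i
    using that by (simp add: y_def of_nat_diff diff_divide_distrib)
  define I where "I i = integral {real i * ?h..real (Suc i) * ?h} (kern f ?t)" for i
  have I: "(kern f ?t has_integral I i) {real i * ?h..real (Suc i) * ?h}" if "i < k" for i
    unfolding I_def
    by (intro integrable_integral kern_integrable f(2) t)
       (use piece_sub[OF _ that, of "real (Suc i) * ?h"] t in \<open>auto simp: divide_right_mono\<close>)
  have "(kern f ?t has_integral (\<Sum>i<k. I i)) {0..?t}"
    using has_integral_sum_pieces[of ?h k "kern f ?t" I] I by simp
  then have ft: "f ?t = (\<Sum>i<k. \<Gamma> *\<^sub>R I i) + p ^ k *\<^sub>R E ?t x0"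
    using f(1) t by (simp add: solution_def picard_def integral_unique p_pow scaleR_sum_right)
  have err: "norm (((1 - p) * p ^ (k - Suc i)) *\<^sub>R y i - \<Gamma> *\<^sub>R I i) \<le> (1 - p) * p ^ (k - Suc i) * \<epsilon>"
    if i: "i < k" for i
  proof -
    let ?J = "{real i * ?h..real (Suc i) * ?h}"
    have 1: "((\<lambda>s. ?w s *\<^sub>R y i - \<Gamma> *\<^sub>R kern f ?t s) has_integral
        ((1 - p) * p ^ (k - Suc i)) *\<^sub>R y i - \<Gamma> *\<^sub>R I i) ?J"
      using has_integral_linear[OF weight[OF i] bounded_linear_scaleR_left[of "y i"]]
      by (intro has_integral_diff has_integral_cmul I[OF i]) (simp add: o_def)
    have 2: "((\<lambda>s. ?w s * \<epsilon>) has_integral (1 - p) * p ^ (k - Suc i) * \<epsilon>) ?J"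
      by (intro has_integral_mult_left weight i)
    have "norm (integral ?J (\<lambda>s. ?w s *\<^sub>R y i - \<Gamma> *\<^sub>R kern f ?t s)) \<le> integral ?J (\<lambda>s. ?w s * \<epsilon>)"
    proof (rule integral_norm_bound_integral)
      fix s assume s: "s \<in> ?J"
      have "?w s *\<^sub>R y i - \<Gamma> *\<^sub>R kern f ?t s
          = ?w s *\<^sub>R (E (?t - real i * ?h) (f (real i * ?h)) - E (?t - s) (f s))"
        by (simp add: y[OF i] kern_def scaleR_diff_right)
      also have "norm \<dots> = ?w s * norm (E (?t - real i * ?h) (f (real i * ?h)) - E (?t - s) (f s))"
        using \<Gamma>_pos by simp
      also have "\<dots> \<le> ?w s * \<epsilon>"
        using \<Gamma>_pos s piece_sub[OF s i] piece_sub[of "real i * ?h", OF _ i]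
        by (intro mult_left_mono unif) (auto simp: distrib_right add_divide_distrib abs_le_iff)
      finally show "norm (?w s *\<^sub>R y i - \<Gamma> *\<^sub>R kern f ?t s) \<le> ?w s * \<epsilon>" .
    qed (use 1 2 in blast)+
    then show ?thesis
      by (simp only: integral_unique[OF 1] integral_unique[OF 2])
  qed
  have total: "(\<Sum>i<k. (1 - p) * p ^ (k - Suc i)) = 1 - p ^ k"
    by (subst sum.nat_diff_reindex) (simp add: one_diff_power_eq sum_distrib_left)
  have \<epsilon>: "0 \<le> \<epsilon>" using unif[of 0 0] t n by simp
  have "((1 - p) *\<^sub>R (\<Sum>i<k. p ^ (k - Suc i) *\<^sub>R y i) + p ^ k *\<^sub>R E ?t x0) - f ?t
      = (\<Sum>i<k. ((1 - p) * p ^ (k - Suc i)) *\<^sub>R y i - \<Gamma> *\<^sub>R I i)"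
    by (simp add: ft scaleR_sum_right sum_subtractf)
  also have "norm \<dots> \<le> (\<Sum>i<k. (1 - p) * p ^ (k - Suc i) * \<epsilon>)"
    by (intro sum_norm_le err) auto
  also have "\<dots> = (1 - p ^ k) * \<epsilon>"
    by (simp only: total flip: sum_distrib_right)
  also have "\<dots> \<le> \<epsilon>"
    using \<epsilon> by (simp add: p_def mult_le_cancel_right1 left_diff_distrib)
  finally show ?thesis by (simp add: y_def)
qed

text \<open>
  Stability: the weights of the recursion are at most \<open>\<Gamma>/n\<close>, so after at most \<open>n\<close> steps Gronwall's
  inequality enlarges the consistency error by a factor that does not depend on \<open>n\<close>.
\<close>

lemma scheme_error:
  fixes n k :: nat and r :: "nat \<Rightarrow> 'a"
  defines "p \<equiv> exp (- \<Gamma> / n)"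
  assumes f: "solution f" "continuous_on {0..1} f" and n: "n \<ge> 1" and k: "k \<le> n"
    and r: "\<And>k. r k = (1 - p) *\<^sub>R (\<Sum>i<k. p ^ (k - Suc i) *\<^sub>R E (real (k - i) / n) (r i))
      + p ^ k *\<^sub>R E (k/n) x0"
    and unif: "\<And>t s s'. t \<in> {0..1} \<Longrightarrow> s \<in> {0..1} \<Longrightarrow> s' \<in> {0..1} \<Longrightarrow> \<bar>s - s'\<bar> \<le> 1/n
       \<Longrightarrow> norm (E (t - s) (f s) - E (t - s') (f s')) \<le> \<epsilon>"
  shows "norm (r k - f (k/n)) \<le> \<epsilon> * exp (op_bound * \<Gamma>)"
proof -
  let ?q = "op_bound * \<Gamma> / n"
  have \<epsilon>: "0 \<le> \<epsilon>" using unif[of 0 0 0] by simp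
  have p: "0 \<le> 1 - p" "1 - p \<le> \<Gamma> / n" "0 < p"
    using \<Gamma>_pos exp_ge_add_one_self[of "- \<Gamma> / n"] by (auto simp: p_def)
  have "norm (r k - f (k/n)) \<le> \<epsilon> + ?q * (\<Sum>i<k. norm (r i - f (i/n)))" if k: "k \<le> n" for k
  proof -
    let ?f = "(1 - p) *\<^sub>R (\<Sum>i<k. p ^ (k - Suc i) *\<^sub>R E (real (k - i) / n) (f (i/n)))
      + p ^ k *\<^sub>R E (k/n) x0"
    have "norm (?f - f (k/n)) \<le> \<epsilon>"
      unfolding p_def
    proof (rule quadrature_error[OF f n k])
      fix s s' assume "s \<in> {0..k/n}" "s' \<in> {0..k/n}" and d: "\<bar>s - s'\<bar> \<le> 1/n"
      moreover have "k/n \<in> {0..1}" using n k by auto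
      ultimately show "norm (E (k/n - s) (f s) - E (k/n - s') (f s')) \<le> \<epsilon>"
        by (intro unif d) auto
    qed
    moreover have "norm (r k - ?f) \<le> ?q * (\<Sum>i<k. norm (r i - f (i/n)))"
    proof -
      have "r k - ?f = (\<Sum>i<k. ((1 - p) * p ^ (k - Suc i)) *\<^sub>R E (real (k - i) / n) (r i - f (i/n)))"
        by (subst r) (simp add: linear_diff[OF linear_E] scaleR_diff_right sum_subtractf scaleR_sum_right)
      also have "norm \<dots> \<le> (\<Sum>i<k. ?q * norm (r i - f (i/n)))"
      proof (rule sum_norm_le)
        fix i assume "i \<in> {..<k}"
        have "norm (((1 - p) * p ^ (k - Suc i)) *\<^sub>R E (real (k - i) / n) (r i - f (i/n)))
            = ((1 - p) * p ^ (k - Suc i)) * norm (E (real (k - i) / n) (r i - f (i/n)))"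
          using p by simp
        also have "\<dots> \<le> (\<Gamma> / n * 1) * (op_bound * norm (r i - f (i/n)))"
          using p k n \<Gamma>_pos by (intro mult_mono power_le_one op_bound(2)) auto
        finally show "norm (((1 - p) * p ^ (k - Suc i)) *\<^sub>R E (real (k - i) / n) (r i - f (i/n)))
            \<le> ?q * norm (r i - f (i/n))"
          by (simp add: mult_ac)
      qed
      finally show ?thesis by (simp add: sum_distrib_left)
    qed
    ultimately show ?thesis
      using norm_triangle_ineq[of "r k - ?f" "?f - f (k/n)"] by simp
  qed
  then have "norm (r k - f (k/n)) \<le> \<epsilon> * (1 + ?q) ^ k"
    using op_bound(1) \<Gamma>_pos k by (intro discrete_gronwall[of ?q n]) auto
  also have "\<dots> \<le> \<epsilon> * (1 + ?q) ^ n"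
    using op_bound(1) \<Gamma>_pos k \<epsilon> by (intro mult_left_mono power_increasing) auto
  also have "\<dots> \<le> \<epsilon> * exp (op_bound * \<Gamma>)"
  proof (intro mult_left_mono exp_ge_one_plus_x_over_n_power_n \<epsilon>)
    have "0 \<le> op_bound * \<Gamma>" using op_bound(1) \<Gamma>_pos by simp
    then show "- real n \<le> op_bound * \<Gamma>" by linarith
  qed (use n in auto)
  finally show ?thesis .
qed

lemma scheme_converges:
  fixes r :: "nat \<Rightarrow> nat \<Rightarrow> 'a"
  assumes f: "solution f" "continuous_on {0..1} f"
    and r: "\<And>n k. n \<ge> 1 \<Longrightarrow> r n k =
      (1 - exp (- \<Gamma> / n)) *\<^sub>R (\<Sum>i<k. exp (- \<Gamma> / n) ^ (k - Suc i) *\<^sub>R E (real (k - i) / n) (r n i))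
      + exp (- \<Gamma> / n) ^ k *\<^sub>R E (real k / n) x0"
  shows "uniform_limit {0..1} (\<lambda>n t. r n (nat \<lfloor>real n * t\<rfloor>)) f sequentially"
proof (rule uniform_limitI)
  fix e :: real assume e: "0 < e"
  \<comment> \<open>Half of the error budget is for the scheme at grid points, half for the oscillation of \<open>f\<close> between them.\<close>
  define \<epsilon> where "\<epsilon> = e / (2 * exp (op_bound * \<Gamma>))"
  have \<epsilon>: "0 < \<epsilon>" "\<epsilon> * exp (op_bound * \<Gamma>) = e / 2" using e by (auto simp: \<epsilon>_def)
  have "continuous_on ({0..1} \<times> {0..1}) (\<lambda>z::real\<times>real. f (snd z))"
    by (rule continuous_on_compose2[OF f(2)]) (auto intro!: continuous_intros)
  then have "continuous_on ({0..1} \<times> {0..1}) (\<lambda>z. E (fst z - snd z) (f (snd z)))"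
    by (intro continuous_intros)
  then have "uniformly_continuous_on ({0..1} \<times> {0..1}) (\<lambda>z. E (fst z - snd z) (f (snd z)))"
    by (intro compact_uniformly_continuous compact_Times) auto
  from this[unfolded uniformly_continuous_on_def, rule_format, OF \<epsilon>(1)] obtain d1 where d1: "0 < d1"
    and d1': "\<forall>z\<in>{0..1} \<times> {0..1}. \<forall>z'\<in>{0..1} \<times> {0..1}. dist z' z < d1
       \<longrightarrow> dist (E (fst z' - snd z') (f (snd z'))) (E (fst z - snd z) (f (snd z))) < \<epsilon>"
    by (elim exE conjE)
  have d1'': "norm (E (t - s) (f s) - E (t - s') (f s')) < \<epsilon>"
    if "t \<in> {0..1}" "s \<in> {0..1}" "s' \<in> {0..1}" "\<bar>s - s'\<bar> < d1" for t s s'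
    using d1'[rule_format, of "(t, s')" "(t, s)"] that by (simp add: dist_Pair_Pair dist_norm)
  have "uniformly_continuous_on {0..1} f"
    by (intro compact_uniformly_continuous f) auto
  from this[unfolded uniformly_continuous_on_def, rule_format, of "e/2"] e obtain d2 where d2: "0 < d2"
    "\<forall>s\<in>{0..1}. \<forall>s'\<in>{0..1}. dist s' s < d2 \<longrightarrow> dist (f s') (f s) < e/2"
    by (elim meta_impE exE conjE) (simp, blast)
  from nat_approx_posE[of "min d1 d2"] d1 d2(1)
  obtain N where N: "1 / real (Suc N) < min d1 d2" by auto
  have "dist (r n (nat \<lfloor>real n * t\<rfloor>)) (f t) < e" if n: "n \<ge> Suc N" and t: "t \<in> {0..1}" for n t
  proof -
    define k where "k = nat \<lfloor>real n * t\<rfloor>"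
    have n1: "n \<ge> 1" using n N by simp
    have h: "1 / real n < d1" "1 / real n < d2"
      using n N frac_le[of 1 1 "real (Suc N)" "real n"] by auto
    have "0 \<le> real n * t" using t by simp
    then have k_le: "real k \<le> real n * t" "real n * t < real k + 1"
      unfolding k_def by linarith+
    have "real n * t \<le> real n" using t by (simp add: mult_left_le)
    with k_le have kn: "k \<le> n" by linarith
    have "dist (r n k) (f (k/n)) \<le> \<epsilon> * exp (op_bound * \<Gamma>)"
      unfolding dist_norm
      by (rule scheme_error[OF f n1 kn r[OF n1]]) (use d1'' h in \<open>auto intro!: less_imp_le\<close>)
    moreover have "\<bar>real k / n - t\<bar> < d2"
    proof -
      have "\<bar>real k / n - t\<bar> = \<bar>real k - real n * t\<bar> / n" using n1 by (simp add: field_simps abs_if)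
      also have "\<dots> \<le> 1 / n" using k_le by (intro divide_right_mono) auto
      finally show ?thesis using h by simp
    qed
    then have "dist (f (k/n)) (f t) < e / 2"
      using kn n1 t by (intro d2(2)[rule_format]) (auto simp: dist_norm)
    ultimately show ?thesis
      using dist_triangle[of "r n k" "f t" "f (k/n)"] \<epsilon>(2) by (simp add: k_def)
  qed
  then show "\<forall>\<^sub>F n in sequentially. \<forall>t\<in>{0..1}. dist (r n (nat \<lfloor>real n * t\<rfloor>)) (f t) < e"
    unfolding eventually_sequentially by blast
qed

end

section \<open>The matrix exponential\<close>

lemma mpower_0 [simp]: "mpower A 0 = mat 1"
  by (simp add: mpower_def)

lemma mpower_Suc: "mpower A (Suc k) = A ** mpower A k"
  by (simp add: mpower_def)

lemma mpower_add: "mpower A (j + k) = mpower A j ** mpower A k"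
  by (induction j) (simp_all add: mpower_Suc matrix_mul_assoc)

lemma mpower_cscale: "mpower (cscale z A) k $ i $ j = z ^ k * mpower A k $ i $ j"
proof (induction k arbitrary: i)
  case (Suc k)
  then show ?case
    by (simp add: mpower_Suc matrix_matrix_mult_def cscale_def sum_distrib_left mult_ac)
qed (simp add: mat_def)

text \<open>
  The sum of the moduli of all entries is submultiplicative, which is all that is needed to compare the
  exponential series of a matrix with a scalar one.
\<close>

lemma norm_mpower_le:
  fixes A :: "complex^'n^'n"
  shows "norm (mpower A k $ i $ j) \<le> (\<Sum>a\<in>UNIV. \<Sum>b\<in>UNIV. norm (A $ a $ b)) ^ k"
proof (induction k arbitrary: i)
  case (Suc k)
  let ?B = "\<Sum>a\<in>UNIV. \<Sum>b\<in>UNIV. norm (A $ a $ b)"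
  have "norm (mpower A (Suc k) $ i $ j) \<le> (\<Sum>l\<in>UNIV. norm (A $ i $ l) * ?B ^ k)"
    unfolding mpower_Suc matrix_matrix_mult_def
    by (auto intro!: sum_norm_le mult_left_mono Suc simp: norm_mult)
  also have "\<dots> = (\<Sum>l\<in>UNIV. norm (A $ i $ l)) * ?B ^ k"
    by (simp add: sum_distrib_right)
  also have "\<dots> \<le> ?B * ?B ^ k"
    by (intro mult_right_mono member_le_sum zero_le_power sum_nonneg) (auto intro!: sum_nonneg)
  finally show ?case by simp
qed (auto simp: mat_def)

text \<open>
  Terms of the power series in \<open>z\<close> of one entry of the exponential. Working with entries
  reduces convergence, continuity and multiplication to the theory of complex power series.
\<close>

definition exp_term :: "complex^'n^'n \<Rightarrow> 'n \<Rightarrow> 'n \<Rightarrow> complex \<Rightarrow> nat \<Rightarrow> complex" where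
  "exp_term A i j z k = mpower A k $ i $ j / fact k * z ^ k"

lemma summable_norm_exp_term: "summable (\<lambda>k. norm (exp_term A i j z k))"
proof (rule summable_comparison_test')
  let ?B = "\<Sum>a\<in>UNIV. \<Sum>b\<in>UNIV. norm (A $ a $ b)"
  show "summable (\<lambda>k. (?B * norm z) ^ k / fact k)"
    using summable_exp[of "?B * norm z"] by (simp add: field_simps)
  show "norm (norm (exp_term A i j z k)) \<le> (?B * norm z) ^ k / fact k" for k
    using mult_right_mono[OF norm_mpower_le[of A k i j], of "norm z ^ k"]
    by (simp add: exp_term_def norm_mult norm_divide norm_power power_mult_distrib divide_right_mono)
qed

lemma sums_exp_term: "exp_term A i j z sums (mexp (cscale z A) $ i $ j)"
proof -
  have entry: "((1 / fact k) *\<^sub>R mpower (cscale z A) k) $ a $ b = exp_term A a b z k" for a b k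
    by (simp add: exp_term_def mpower_cscale scaleR_conv_of_real[where 'a = complex])
  have "(\<lambda>k. (1 / fact k) *\<^sub>R mpower (cscale z A) k) sums (\<chi> a b. suminf (exp_term A a b z))"
    unfolding sums_def
  proof (intro vec_tendstoI)
    fix a b
    have "exp_term A a b z sums suminf (exp_term A a b z)"
      by (rule summable_sums[OF summable_norm_cancel[OF summable_norm_exp_term]])
    then show "(\<lambda>n. (\<Sum>k<n. (1 / fact k) *\<^sub>R mpower (cscale z A) k) $ a $ b)
        \<longlonglongrightarrow> (\<chi> a b. suminf (exp_term A a b z)) $ a $ b"
      by (simp add: sums_def entry del: vector_scaleR_component)
  qed
  then have "mexp (cscale z A) = (\<chi> a b. suminf (exp_term A a b z))"
    unfolding mexp_def by (rule sums_unique[symmetric])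
  then show ?thesis
    using summable_sums[OF summable_norm_cancel[OF summable_norm_exp_term]] by simp
qed

text \<open>
  Group law: the Cauchy product of the series of entries, summed over the inner index of the matrix product,
  combines \<open>mpower A m ** mpower A (k - m)\<close> into \<open>mpower A k\<close>, and the binomial theorem does the rest.
\<close>

lemma mexp_add: "mexp (cscale (z + w) A) = mexp (cscale z A) ** mexp (cscale w A)"
proof -
  have "mexp (cscale (z + w) A) $ i $ j = (mexp (cscale z A) ** mexp (cscale w A)) $ i $ j" for i j
  proof -
    have "(\<lambda>k. \<Sum>l\<in>UNIV. \<Sum>m\<le>k. exp_term A i l z m * exp_term A l j w (k - m)) sums
      (\<Sum>l\<in>UNIV. suminf (exp_term A i l z) * suminf (exp_term A l j w))"
      by (intro sums_sum Cauchy_product_sums summable_norm_exp_term)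
    moreover have "(\<Sum>l\<in>UNIV. \<Sum>m\<le>k. exp_term A i l z m * exp_term A l j w (k - m))
        = exp_term A i j (z + w) k" for k
    proof -
      have "(\<Sum>l\<in>UNIV. \<Sum>m\<le>k. exp_term A i l z m * exp_term A l j w (k - m))
         = (\<Sum>m\<le>k. (z ^ m / fact m) * (w ^ (k - m) / fact (k - m)) *
             (\<Sum>l\<in>UNIV. mpower A m $ i $ l * mpower A (k - m) $ l $ j))"
        by (subst sum.swap) (simp add: exp_term_def sum_distrib_left mult_ac)
      also have "\<dots> = (\<Sum>m\<le>k. (z ^ m / fact m) * (w ^ (k - m) / fact (k - m))) * mpower A k $ i $ j"
        unfolding sum_distrib_right
      proof (intro sum.cong refl arg_cong2[where f="(*)"])
        fix m assume "m \<in> {..k}"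
        then have "mpower A k = mpower A m ** mpower A (k - m)"
          by (simp flip: mpower_add)
        then show "(\<Sum>l\<in>UNIV. mpower A m $ i $ l * mpower A (k - m) $ l $ j) = mpower A k $ i $ j"
          by (simp add: matrix_matrix_mult_def)
      qed
      also have "(\<Sum>m\<le>k. (z ^ m / fact m) * (w ^ (k - m) / fact (k - m))) = (z + w) ^ k / fact k"
        using exp_series_add_commuting[of z w k]
        by (simp add: mult.commute scaleR_conv_of_real divide_inverse)
      finally show ?thesis by (simp add: exp_term_def)
    qed
    ultimately have "exp_term A i j (z + w) sums
        (\<Sum>l\<in>UNIV. suminf (exp_term A i l z) * suminf (exp_term A l j w))"
      by simp
    from sums_unique2[OF sums_exp_term this] show ?thesis
      by (simp add: matrix_matrix_mult_def sums_unique[OF sums_exp_term, symmetric])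
  qed
  then show ?thesis by (simp add: vec_eq_iff)
qed

lemma mexp_0: "mexp (cscale 0 A) = mat 1"
proof -
  have "mexp (cscale 0 A) $ i $ j = mat 1 $ i $ j" for i j
  proof -
    have "exp_term A i j 0 sums exp_term A i j 0 0"
      using sums_single[of 0 "exp_term A i j 0"]
      by (rule sums_cong[THEN iffD1, rotated]) (auto simp: exp_term_def)
    from sums_unique2[OF sums_exp_term this] show ?thesis
      by (simp add: exp_term_def)
  qed
  then show ?thesis by (simp add: vec_eq_iff)
qed

lemma mpower_mexp: "mpower (mexp (cscale z A)) k = mexp (cscale (of_nat k * z) A)"
  by (induction k) (simp_all add: mexp_0 mpower_Suc algebra_simps flip: mexp_add)

lemma continuous_mexp_entry: "isCont (\<lambda>z. mexp (cscale z A) $ i $ j) z"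
proof -
  have "isCont (\<lambda>z. \<Sum>k. mpower A k $ i $ j / fact k * z ^ k) z"
    by (rule isCont_powser_converges_everywhere)
       (use summable_norm_cancel[OF summable_norm_exp_term] in \<open>simp add: exp_term_def\<close>)
  then show ?thesis
    using sums_unique[OF sums_exp_term[of A i j]] by (simp add: exp_term_def[abs_def])
qed

lemma continuous_on_mexp [continuous_intros]:
  assumes "continuous_on S f"
  shows "continuous_on S (\<lambda>x. mexp (cscale (f x) A))"
proof -
  have "continuous_on UNIV (\<lambda>z. mexp (cscale z A) $ i $ j)" for i j
    using continuous_at_imp_continuous_on continuous_mexp_entry by blast
  then have *: "continuous_on S (\<lambda>x. mexp (cscale (f x) A) $ i $ j)" for i j
    using continuous_on_compose2[OF _ assms] by blast
  have "continuous_on S (\<lambda>x. \<chi> i j. mexp (cscale (f x) A) $ i $ j)"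
    by (intro continuous_on_vec_lambda *)
  then show ?thesis by simp
qed

lemma adjoint_mult: "adjoint_mat (A ** B) = adjoint_mat B ** adjoint_mat A"
  by (simp add: adjoint_mat_def vec_eq_iff matrix_matrix_mult_def transpose_def mult_ac)

lemma adjoint_adjoint [simp]: "adjoint_mat (adjoint_mat A) = A"
  by (simp add: adjoint_mat_def vec_eq_iff transpose_def)

lemma adjoint_mpower: "adjoint_mat (mpower A k) = mpower (adjoint_mat A) k"
proof (induction k)
  case (Suc k)
  have *: "mpower B (Suc k) = mpower B k ** B" for B :: "complex^'a^'a"
    using mpower_add[of B k 1] by (simp add: mpower_Suc)
  show ?case
    by (subst mpower_Suc) (simp only: adjoint_mult Suc *)
qed (simp add: adjoint_mat_def vec_eq_iff transpose_def mat_def)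

text \<open>
  For Hermitian \<open>A\<close> all powers are Hermitian, so conjugating an entry of the series only conjugates \<open>z\<close>.
  At imaginary \<open>z\<close> this says that the adjoint is the inverse.
\<close>

lemma adjoint_mexp:
  assumes "hermitian A"
  shows "adjoint_mat (mexp (cscale z A)) = mexp (cscale (cnj z) A)"
proof -
  have "cnj (mexp (cscale z A) $ j $ i) = mexp (cscale (cnj z) A) $ i $ j" for i j
  proof -
    have "cnj (mpower A k $ j $ i) = mpower A k $ i $ j" for k
      using adjoint_mpower[of A k] assms
      by (simp add: hermitian_def) (simp add: adjoint_mat_def transpose_def vec_eq_iff)
    then have "(\<lambda>k. cnj (exp_term A j i z k)) = exp_term A i j (cnj z)"
      by (auto simp: exp_term_def)
    then have "exp_term A i j (cnj z) sums cnj (mexp (cscale z A) $ j $ i)"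
      using sums_exp_term[of A j i z, folded sums_cnj[of "exp_term A j i z"]] by simp
    from sums_unique2[OF this sums_exp_term] show ?thesis .
  qed
  then show ?thesis by (simp add: adjoint_mat_def vec_eq_iff transpose_def)
qed

section \<open>Positivity and density matrices\<close>

definition qform :: "complex^'n^'n \<Rightarrow> complex^'n \<Rightarrow> complex" where
  "qform A v = (\<Sum>i\<in>UNIV. cnj (v $ i) * (A *v v) $ i)"

definition psd :: "complex^'n^'n \<Rightarrow> bool" where
  "psd A \<longleftrightarrow> hermitian A \<and> (\<forall>v. 0 \<le> Re (qform A v))"

lemma density_iff: "A \<in> density_matrices \<longleftrightarrow> psd A \<and> trace A = 1"
  by (auto simp: density_matrices_def psd_def qform_def)

lemma hermitian_iff: "hermitian A \<longleftrightarrow> (\<forall>i j. cnj (A $ j $ i) = A $ i $ j)"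
  by (auto simp: hermitian_def adjoint_mat_def vec_eq_iff transpose_def)

lemma qform_expand: "qform A v = (\<Sum>i\<in>UNIV. \<Sum>j\<in>UNIV. cnj (v $ i) * A $ i $ j * v $ j)"
  by (simp add: qform_def matrix_vector_mult_def sum_distrib_left mult.assoc)

lemma qform_conj: "qform (U ** M ** adjoint_mat U) v = qform M (adjoint_mat U *v v)"
proof -
  let ?w = "M *v (adjoint_mat U *v v)"
  have adj: "cnj ((adjoint_mat U *v v) $ j) = (\<Sum>i\<in>UNIV. cnj (v $ i) * U $ i $ j)" for j
    by (simp add: matrix_vector_mult_def adjoint_mat_def transpose_def mult.commute)
  have "qform (U ** M ** adjoint_mat U) v = (\<Sum>i\<in>UNIV. cnj (v $ i) * (U *v ?w) $ i)"
    by (simp add: qform_def matrix_vector_mul_assoc matrix_mul_assoc)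
  also have "\<dots> = (\<Sum>i\<in>UNIV. \<Sum>j\<in>UNIV. cnj (v $ i) * U $ i $ j * ?w $ j)"
    by (simp add: matrix_vector_mult_def[of U] sum_distrib_left mult.assoc)
  also have "\<dots> = (\<Sum>j\<in>UNIV. \<Sum>i\<in>UNIV. cnj (v $ i) * U $ i $ j * ?w $ j)"
    by (rule sum.swap)
  also have "\<dots> = (\<Sum>j\<in>UNIV. cnj ((adjoint_mat U *v v) $ j) * ?w $ j)"
    by (simp only: adj sum_distrib_right)
  finally show ?thesis by (simp add: qform_def)
qed

lemma psd_conj:
  assumes "psd M"
  shows "psd (U ** M ** adjoint_mat U)"
  using assms by (simp add: psd_def qform_conj hermitian_def adjoint_mult matrix_mul_assoc)

text \<open>
  The partial trace sums the quadratic form over the product vectors of \<open>v\<close> with each basis vector of the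
  environment; these are the vectors on the right.
\<close>

lemma qform_partial_trace:
  "qform (partial_trace M) v = (\<Sum>k\<in>UNIV. qform M (\<chi> z. if snd z = k then v $ fst z else 0))"
proof -
  have "qform M (\<chi> z. if snd z = k then v $ fst z else 0)
      = (\<Sum>i\<in>UNIV. \<Sum>j\<in>UNIV. cnj (v $ i) * M $ (i, k) $ (j, k) * v $ j)" for k
  proof -
    have "qform M (\<chi> z. if snd z = k then v $ fst z else 0) =
      (\<Sum>i\<in>UNIV. \<Sum>a\<in>UNIV. \<Sum>j\<in>UNIV. \<Sum>b\<in>UNIV. if b = k then if a = k
          then cnj (v $ i) * M $ (i, a) $ (j, b) * v $ j else 0 else 0)"
      unfolding qform_expand UNIV_Times_UNIV[symmetric] sum.cartesian_product'
      by (intro sum.cong refl) auto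
    also have "\<dots> = (\<Sum>i\<in>UNIV. \<Sum>j\<in>UNIV. cnj (v $ i) * M $ (i, k) $ (j, k) * v $ j)"
    proof (intro sum.cong refl)
      fix i
      have "(\<Sum>a\<in>UNIV. \<Sum>j\<in>UNIV. \<Sum>b\<in>UNIV. if b = k then if a = k
          then cnj (v $ i) * M $ (i, a) $ (j, b) * v $ j else 0 else 0)
        = (\<Sum>a\<in>UNIV. \<Sum>j\<in>UNIV. if a = k then cnj (v $ i) * M $ (i, a) $ (j, k) * v $ j else 0)"
        by (simp only: sum.delta finite_class.finite UNIV_I if_True)
      also have "\<dots> = (\<Sum>j\<in>UNIV. cnj (v $ i) * M $ (i, k) $ (j, k) * v $ j)"
        by (subst sum.swap) simp
      finally show "(\<Sum>a\<in>UNIV. \<Sum>j\<in>UNIV. \<Sum>b\<in>UNIV. if b = k then if a = k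
          then cnj (v $ i) * M $ (i, a) $ (j, b) * v $ j else 0 else 0)
        = (\<Sum>j\<in>UNIV. cnj (v $ i) * M $ (i, k) $ (j, k) * v $ j)" .
    qed
    finally show ?thesis .
  qed
  then have "(\<Sum>k\<in>UNIV. qform M (\<chi> z. if snd z = k then v $ fst z else 0)) =
     (\<Sum>k\<in>UNIV. \<Sum>i\<in>UNIV. \<Sum>j\<in>UNIV. cnj (v $ i) * M $ (i, k) $ (j, k) * v $ j)"
    by simp
  also have "\<dots> = (\<Sum>i\<in>UNIV. \<Sum>k\<in>UNIV. \<Sum>j\<in>UNIV. cnj (v $ i) * M $ (i, k) $ (j, k) * v $ j)"
    by (rule sum.swap)
  also have "\<dots> = (\<Sum>i\<in>UNIV. \<Sum>j\<in>UNIV. \<Sum>k\<in>UNIV. cnj (v $ i) * M $ (i, k) $ (j, k) * v $ j)"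
    by (intro sum.cong refl sum.swap)
  finally show ?thesis
    by (simp add: qform_expand partial_trace_def sum_distrib_left sum_distrib_right)
qed

lemma psd_partial_trace:
  assumes "psd M"
  shows "psd (partial_trace M)"
proof -
  have "0 \<le> Re (qform (partial_trace M) v)" for v
    using assms by (auto simp: psd_def qform_partial_trace intro: sum_nonneg)
  moreover have "hermitian (partial_trace M)"
    using assms by (auto simp: psd_def hermitian_iff partial_trace_def)
  ultimately show ?thesis by (simp add: psd_def)
qed

lemma trace_partial_trace: "trace (partial_trace M) = trace M"
  unfolding trace_def partial_trace_def UNIV_Times_UNIV[symmetric] sum.cartesian_product'
  by simp

lemma trace_tensor: "trace (tensor A B) = trace A * trace B"
  unfolding trace_def tensor_def UNIV_Times_UNIV[symmetric] sum.cartesian_product'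
  by (simp add: sum_product)

text \<open>
  Cholesky factorization: a positive matrix of size two is \<open>w1 w1\<^sup>\<dagger> + w2 w2\<^sup>\<dagger>\<close>.
  Writing \<open>a\<close>, \<open>b\<close>, \<open>cnj b\<close>, \<open>d\<close> for its entries, \<open>w1\<close> reproduces the first row and column, and \<open>w2\<close> is
  supported on the second basis vector and carries the Schur complement of \<open>a\<close>.
\<close>

lemma psd2_decomp:
  fixes A :: "complex^2^2"
  assumes "psd A"
  obtains w1 w2 :: "complex^2" where
    "\<And>i j. A $ i $ j = w1 $ i * cnj (w1 $ j) + w2 $ i * cnj (w2 $ j)"
proof -
  have herm: "cnj (A $ j $ i) = A $ i $ j" for i j
    using assms by (simp add: psd_def hermitian_iff)
  define b where "b = A $ 1 $ 2"
  have q: "0 \<le> Re (qform A (vector [x, y]))" for x y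
    using assms by (simp add: psd_def)
  obtain a where a: "A $ 1 $ 1 = complex_of_real a"
    using herm[of 1 1] by (metis Reals_cases Reals_cnj_iff)
  obtain d where d: "A $ 2 $ 2 = complex_of_real d"
    using herm[of 2 2] by (metis Reals_cases Reals_cnj_iff)
  have b': "A $ 2 $ 1 = cnj b"
    using herm[of 1 2] by (simp add: b_def)
  have q': "0 \<le> a * (cmod x)\<^sup>2 + d * (cmod y)\<^sup>2 + 2 * Re (cnj x * b * y)" for x y
  proof -
    have "qform A (vector [x, y]) = of_real a * (x * cnj x) + of_real d * (y * cnj y)
        + (cnj x * b * y + cnj (cnj x * b * y))"
      by (simp add: qform_expand sum_2 a d b' algebra_simps flip: b_def)
    also have "\<dots> = of_real (a * (cmod x)\<^sup>2 + d * (cmod y)\<^sup>2 + 2 * Re (cnj x * b * y))"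
      by (simp only: complex_add_cnj flip: complex_norm_square of_real_mult of_real_add)
    finally show ?thesis using q[of x y] by simp
  qed
  have a0: "0 \<le> a" using q'[of 1 0] by simp
  have d0: "0 \<le> d" using q'[of 0 1] by simp
  show ?thesis
  proof (cases "a = 0")
    case True
    \<comment> \<open>With \<open>a = 0\<close> the quadratic form at \<open>(x, 1)\<close> is affine in \<open>x\<close>, so it takes negative values unless \<open>b = 0\<close>.\<close>
    have "b = 0"
    proof (rule ccontr)
      assume b: "b \<noteq> 0"
      define x where "x = - of_real (d + 1) / cnj b"
      have "cnj x * b * 1 = - of_real (d + 1)"
        using b by (simp add: x_def)
      then have "0 \<le> d - 2 * (d + 1)"
        using q'[of x 1] True by simp
      with d0 show False by simp
    qed
    define w :: "complex^2" where "w = vector [0, of_real (sqrt d)]"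
    have "\<forall>i j. A $ i $ j = 0 $ i * cnj (0 $ j) + w $ i * cnj (w $ j)"
      using True a d b' d0 \<open>b = 0\<close> by (simp add: forall_2 w_def b_def flip: of_real_mult)
    then show ?thesis using that[of 0 w] by blast
  next
    case False
    then have a1: "0 < a" using a0 by simp
    \<comment> \<open>The test vector \<open>(-b, a)\<close> is orthogonal to the first row and gives \<open>a\<close> times the determinant.\<close>
    have "0 \<le> a * (cmod b)\<^sup>2 + d * a\<^sup>2 + 2 * Re (- (b * cnj b) * of_real a)"
      using q'[of "- b" "of_real a"] by (simp add: mult.commute)
    also have "- (b * cnj b) * of_real a = of_real (- (a * (cmod b)\<^sup>2))"
      by (simp flip: complex_norm_square)
    finally have "0 \<le> a * (a * d - (cmod b)\<^sup>2)"
      by (simp add: algebra_simps power2_eq_square)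
    then have e: "0 \<le> d - (cmod b)\<^sup>2 / a"
      using a1 by (simp add: zero_le_mult_iff field_simps)
    have sa: "complex_of_real (sqrt a) * complex_of_real (sqrt a) = of_real a"
      using a1 by (simp flip: of_real_mult)
    have "of_real d = cnj b / of_real (sqrt a) * (b / of_real (sqrt a))
        + complex_of_real (sqrt (d - (cmod b)\<^sup>2 / a)) * of_real (sqrt (d - (cmod b)\<^sup>2 / a))"
    proof -
      have "cnj b / of_real (sqrt a) * (b / of_real (sqrt a)) = of_real ((cmod b)\<^sup>2 / a)"
        using complex_norm_square[of b] by (simp add: sa mult.commute)
      moreover have "complex_of_real (sqrt (d - (cmod b)\<^sup>2 / a)) * of_real (sqrt (d - (cmod b)\<^sup>2 / a))
          = of_real (d - (cmod b)\<^sup>2 / a)"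
        using e by (simp flip: of_real_mult del: of_real_diff)
      ultimately show ?thesis by simp
    qed
    moreover have "\<forall>i j. A $ i $ j =
       vector [of_real (sqrt a), cnj b / of_real (sqrt a)] $ i
         * cnj (vector [of_real (sqrt a), cnj b / of_real (sqrt a)] $ j)
       + (vector [0, of_real (sqrt (d - (cmod b)\<^sup>2 / a))] :: complex^2) $ i
         * cnj ((vector [0, of_real (sqrt (d - (cmod b)\<^sup>2 / a))] :: complex^2) $ j)"
      using a1 calculation by (simp add: forall_2 a d b' sa flip: b_def)
    ultimately show ?thesis using that by blast
  qed
qed

text \<open>
  Decomposing the environment factor into rank-one terms \<open>w w\<^sup>\<dagger>\<close> reduces the quadratic form of the tensor
  product to those of \<open>A\<close> at the contractions of \<open>v\<close> with \<open>w\<close>.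
\<close>

lemma psd_tensor:
  fixes A :: "complex^'n^'n" and B :: "complex^2^2"
  assumes A: "psd A" and B: "psd B"
  shows "psd (tensor A B)"
proof -
  obtain w1 w2 :: "complex^2" where
    w: "\<And>i j. B $ i $ j = w1 $ i * cnj (w1 $ j) + w2 $ i * cnj (w2 $ j)"
    using psd2_decomp[OF B] by metis
  define u where "u w v = (\<chi> i. \<Sum>k\<in>UNIV. cnj (w $ k) * v $ (i, k))"
    for w :: "complex^2" and v :: "complex^('n \<times> 2)"
  have u: "qform A (u w v) = (\<Sum>i\<in>UNIV. \<Sum>k\<in>UNIV. \<Sum>j\<in>UNIV. \<Sum>l\<in>UNIV.
      cnj (v $ (i, k)) * A $ i $ j * (w $ k * cnj (w $ l)) * v $ (j, l))" for w v
    unfolding qform_expand u_def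
    by (simp add: sum_2 algebra_simps sum.distrib)
  have "qform (tensor A B) v = qform A (u w1 v) + qform A (u w2 v)" for v
    unfolding u unfolding qform_expand tensor_def UNIV_Times_UNIV[symmetric]
      sum.cartesian_product'
    by (simp add: w algebra_simps flip: sum.distrib)
  then have "0 \<le> Re (qform (tensor A B) v)" for v
    using A by (simp add: psd_def)
  moreover have "hermitian (tensor A B)"
    using A B by (auto simp: psd_def hermitian_iff tensor_def)
  ultimately show ?thesis by (simp add: psd_def)
qed

lemma closed_density: "closed (density_matrices :: (complex^'n^'n) set)"
proof -
  have "density_matrices = (\<Inter>i j. {A :: complex^'n^'n. cnj (A $ j $ i) = A $ i $ j})
      \<inter> (\<Inter>v. {A. 0 \<le> Re (qform A v)}) \<inter> {A. trace A = 1}"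
    by (auto simp: density_iff psd_def hermitian_iff)
  moreover have "closed \<dots>"
    unfolding qform_expand trace_def
    by (intro closed_Int closed_INT ballI closed_Collect_eq closed_Collect_le continuous_intros)
  ultimately show ?thesis by simp
qed

lemma convex_density: "convex (density_matrices :: (complex^'n^'n) set)"
proof (rule convexI)
  fix A B :: "complex^'n^'n" and s t :: real
  assume *: "A \<in> density_matrices" "B \<in> density_matrices" "0 \<le> s" "0 \<le> t" "s + t = 1"
  have "qform (s *\<^sub>R A + t *\<^sub>R B) v = s *\<^sub>R qform A v + t *\<^sub>R qform B v" for v
    by (simp add: qform_expand scaleR_sum_right algebra_simps flip: sum.distrib)
  moreover have "trace (s *\<^sub>R A + t *\<^sub>R B) = s *\<^sub>R trace A + t *\<^sub>R trace B"
    by (simp add: trace_def scaleR_sum_right sum.distrib)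
  moreover have "s *\<^sub>R 1 + t *\<^sub>R 1 = (1 :: complex)"
    using *(5) by (metis scaleR_add_left scaleR_one)
  ultimately show "s *\<^sub>R A + t *\<^sub>R B \<in> density_matrices"
    using * by (simp add: density_iff psd_def hermitian_iff)
qed

text \<open>
  In the rank-one decomposition the trace is the sum of the squared moduli of all components, so each
  component has modulus at most \<open>1\<close>.
\<close>

lemma bounded_density: "bounded (density_matrices :: (complex^2^2) set)"
proof (rule boundedI)
  fix A :: "complex^2^2" assume A: "A \<in> density_matrices"
  then obtain w1 w2 :: "complex^2" where
    w: "\<And>i j. A $ i $ j = w1 $ i * cnj (w1 $ j) + w2 $ i * cnj (w2 $ j)"
    using psd2_decomp density_iff by metis
  have "complex_of_real ((cmod (w1 $ 1))\<^sup>2 + (cmod (w2 $ 1))\<^sup>2 + (cmod (w1 $ 2))\<^sup>2 + (cmod (w2 $ 2))\<^sup>2)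
      = trace A"
    by (simp only: trace_def sum_2 w of_real_add complex_norm_square add.assoc)
  also have "trace A = of_real 1" using A by (simp add: density_iff)
  finally have tr: "(cmod (w1 $ 1))\<^sup>2 + (cmod (w2 $ 1))\<^sup>2 + (cmod (w1 $ 2))\<^sup>2 + (cmod (w2 $ 2))\<^sup>2 = 1"
    using of_real_eq_iff by blast
  have "cmod (w1 $ i) \<le> 1" "cmod (w2 $ i) \<le> 1" for i
  proof -
    note nonneg = zero_le_power2[of "cmod (w1 $ 1)"] zero_le_power2[of "cmod (w2 $ 1)"]
      zero_le_power2[of "cmod (w1 $ 2)"] zero_le_power2[of "cmod (w2 $ 2)"]
    have "(cmod (w1 $ i))\<^sup>2 \<le> 1" "(cmod (w2 $ i))\<^sup>2 \<le> 1"
      using exhaust_2[of i] tr nonneg by (elim disjE; simp only:; linarith)+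
    then show "cmod (w1 $ i) \<le> 1" "cmod (w2 $ i) \<le> 1"
      using power2_le_imp_le[of _ 1] by simp_all
  qed
  then have "cmod (A $ i $ j) \<le> 1 + 1" for i j
    unfolding w by (intro order_trans[OF norm_triangle_ineq] add_mono)
      (simp_all add: norm_mult mult_le_one)
  then have "(\<Sum>i\<in>UNIV. \<Sum>j\<in>UNIV. norm (A $ i $ j)) \<le> (\<Sum>i\<in>(UNIV::2 set). \<Sum>j\<in>(UNIV::2 set). 1 + 1)"
    by (intro sum_mono)
  moreover have "norm A \<le> (\<Sum>i\<in>UNIV. \<Sum>j\<in>UNIV. norm (A $ i $ j))"
  proof -
    have "norm A \<le> (\<Sum>i\<in>UNIV. norm (A $ i))"
      unfolding norm_vec_def[of A] by (rule L2_set_le_sum) simp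
    also have "\<dots> \<le> (\<Sum>i\<in>UNIV. \<Sum>j\<in>UNIV. norm (A $ i $ j))"
      unfolding norm_vec_def[of "A $ i" for i] by (intro sum_mono L2_set_le_sum) simp
    finally show ?thesis .
  qed
  ultimately show "norm A \<le> 8" by simp
qed

section \<open>The reduced evolution\<close>

lemma linear_evol: "linear (evol H \<beta> t)"
proof (rule linearI)
  have tensor: "tensor (A + B) C = tensor A C + tensor B C" "tensor (r *\<^sub>R A) C = r *\<^sub>R tensor A C"
    for A B :: "complex^'n^'n" and C :: "complex^'m^'m" and r :: real
    by (simp_all add: tensor_def vec_eq_iff distrib_right)
  have ptrace: "partial_trace (A + B) = partial_trace A + partial_trace B"
    "partial_trace (r *\<^sub>R A) = r *\<^sub>R partial_trace A"
    for A B :: "complex^('n::finite \<times> 'm::finite)^('n \<times> 'm)" and r :: real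
    by (simp_all add: partial_trace_def vec_eq_iff sum.distrib scaleR_sum_right)
  have mult: "(r *\<^sub>R A) ** B = r *\<^sub>R (A ** B)" "A ** (r *\<^sub>R B) = r *\<^sub>R (A ** B)"
    for A B :: "complex^'n^'n" and r :: real
    by (simp_all add: matrix_matrix_mult_def vec_eq_iff scaleR_sum_right)
  have mult_add: "(A + B) ** C = A ** C + B ** C" for A B C :: "complex^'n^'n"
    by (simp add: matrix_matrix_mult_def vec_eq_iff distrib_right sum.distrib)
  show "evol H \<beta> t (\<rho> + \<rho>') = evol H \<beta> t \<rho> + evol H \<beta> t \<rho>'" for \<rho> \<rho>'
    by (simp add: evol_def tensor ptrace matrix_add_ldistrib mult_add)
  show "evol H \<beta> t (r *\<^sub>R \<rho>) = r *\<^sub>R evol H \<beta> t \<rho>" for r \<rho>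
    by (simp add: evol_def tensor ptrace mult)
qed

lemma continuous_evol: "continuous_on UNIV (\<lambda>(t, \<rho>). evol H \<beta> t \<rho>)"
proof -
  have "continuous_on UNIV (\<lambda>z. mexp (cscale (c * of_real (fst z)) H))" for c and H :: "complex^'n^'n"
    by (intro continuous_intros)
  then show ?thesis
    unfolding evol_def partial_trace_def matrix_matrix_mult_def tensor_def case_prod_unfold
    by (intro continuous_intros)
qed

lemma evol_0:
  assumes "trace \<beta> = 1"
  shows "evol H \<beta> 0 \<rho> = \<rho>"
  using assms by (simp add: evol_def mexp_0 vec_eq_iff partial_trace_def tensor_def trace_def
      flip: sum_distrib_left)

lemma evol_conj:
  assumes "hermitian H"
  shows "evol H \<beta> t \<rho> = partial_trace (mexp (cscale (- \<i> * of_real t) H) ** tensor \<rho> \<beta>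
     ** adjoint_mat (mexp (cscale (- \<i> * of_real t) H)))"
  using adjoint_mexp[OF assms] by (simp add: evol_def)

lemma evol_density:
  assumes "hermitian H" "\<beta> \<in> density_matrices" "\<rho> \<in> density_matrices"
  shows "evol H \<beta> t \<rho> \<in> density_matrices"
proof -
  let ?U = "mexp (cscale (- \<i> * of_real t) H)"
  have "adjoint_mat ?U ** ?U = mat 1"
    using adjoint_mexp[OF assms(1)] mexp_add[of "\<i> * of_real t" "- \<i> * of_real t" H]
    by (simp add: mexp_0)
  then have "trace (?U ** tensor \<rho> \<beta> ** adjoint_mat ?U) = trace \<rho> * trace \<beta>"
    by (subst trace_mul_sym) (simp add: matrix_mul_assoc trace_tensor)
  then show ?thesis
    using assms unfolding evol_conj[OF assms(1)] density_iff
    by (auto simp: trace_partial_trace intro!: psd_partial_trace psd_conj psd_tensor)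
qed

section \<open>The collision model as a quadrature rule\<close>

text \<open>
  The recursion indexed by the collision \<open>i = k - j\<close> at which the site was last replaced. Splitting the weight
  \<open>p ^ (k - 1)\<close> of the history without any reset as \<open>(1 - p) p ^ (k - 1) + p ^ k\<close> puts the cell
  \<open>i = 0\<close> on the same footing as all others, and makes the formula valid for \<open>k = 0\<close> too.
\<close>

lemma reduced_state_from_start:
  fixes U :: op_joint and \<beta> :: op_sys and k :: nat
  defines "G \<equiv> \<lambda>j \<rho>. partial_trace (mpower U j ** tensor \<rho> \<beta> ** mpower (adjoint_mat U) j)"
  assumes G0: "G 0 \<rho>0 = \<rho>0"
  shows "reduced_state U \<beta> p \<rho>0 k =
    (1 - p) *\<^sub>R (\<Sum>i<k. p ^ (k - Suc i) *\<^sub>R G (k - i) (reduced_state U \<beta> p \<rho>0 i)) + p ^ k *\<^sub>R G k \<rho>0"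
proof (cases k)
  case 0
  then show ?thesis using G0 by (simp add: reduced_state.simps)
next
  case (Suc m)
  let ?r = "reduced_state U \<beta> p \<rho>0"
  let ?S = "\<Sum>i\<in>{1..m}. p ^ (m - i) *\<^sub>R G (Suc m - i) (?r i)"
  have "(\<Sum>j\<in>{1..m}. p ^ (j - 1) *\<^sub>R G j (?r (Suc m - j))) = ?S"
    by (rule sum.reindex_bij_witness[of _ "\<lambda>i. Suc m - i" "\<lambda>i. Suc m - i"]) auto
  then have r: "?r (Suc m) = (1 - p) *\<^sub>R ?S + p ^ m *\<^sub>R G (Suc m) \<rho>0"
    by (subst reduced_state.simps) (simp add: G_def)
  have "{..<Suc m} = insert 0 {1..m}" by auto
  then have "(\<Sum>i<Suc m. p ^ (m - i) *\<^sub>R G (Suc m - i) (?r i)) = p ^ m *\<^sub>R G (Suc m) (?r 0) + ?S"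
    by simp
  moreover have "?r 0 = \<rho>0" by (simp add: reduced_state.simps)
  ultimately show ?thesis
    unfolding Suc r by (simp add: scaleR_add_right algebra_simps)
qed

text \<open>
  By the group law \<open>j\<close> collisions of duration \<open>1/n\<close> with the same site are one interaction of duration \<open>j/n\<close>.
\<close>

lemma collision_state_rec:
  fixes n k :: nat
  assumes H: "hermitian H" and \<beta>: "trace \<beta> = 1"
  shows "collision_state H \<beta> \<Gamma> \<rho>0 n k =
    (1 - exp (- \<Gamma> / n)) *\<^sub>R (\<Sum>i<k. exp (- \<Gamma> / n) ^ (k - Suc i) *\<^sub>R
        evol H \<beta> (real (k - i) / n) (collision_state H \<beta> \<Gamma> \<rho>0 n i))
    + exp (- \<Gamma> / n) ^ k *\<^sub>R evol H \<beta> (real k / n) \<rho>0"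
proof -
  let ?U = "mexp (cscale (- \<i> * of_real (1 / real n)) H)"
  have G: "partial_trace (mpower ?U j ** tensor \<rho> \<beta> ** mpower (adjoint_mat ?U) j) = evol H \<beta> (real j / n) \<rho>"
    for j \<rho>
    unfolding evol_def adjoint_mexp[OF H] mpower_mexp by (simp add: mult.commute[of \<i>])
  have "partial_trace (mpower ?U 0 ** tensor \<rho>0 \<beta> ** mpower (adjoint_mat ?U) 0) = \<rho>0"
    unfolding G by (simp add: evol_0[OF \<beta>])
  from reduced_state_from_start[OF this, of "exp (- \<Gamma> / n)" k] show ?thesis
    unfolding G collision_state_def .
qed

text \<open>
  The essential supremum over a space of measure zero is \<open>-\<infinity>\<close>, so there the norms of the differences
  would not tend to \<open>0\<close>.
\<close>

lemma tendsto_Linfty_uniform_limit: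
  fixes F :: "nat \<Rightarrow> 'a \<Rightarrow> 'b::euclidean_space"
  assumes M: "emeasure M (space M) \<noteq> 0"
    and F: "\<And>n. F n \<in> borel_measurable M" "\<And>n. bounded (F n ` space M)"
    and g: "g \<in> borel_measurable M" "bounded (g ` space M)"
    and lim: "uniform_limit (space M) F g sequentially"
  shows "tendsto_Linfty M F g"
proof -
  have le: "Linfty_norm M f \<le> ereal c" if "f \<in> borel_measurable M" "\<And>x. x \<in> space M \<Longrightarrow> norm (f x) \<le> c"
    for f :: "'a \<Rightarrow> 'b" and c
    unfolding Linfty_norm_def using that by (intro esssup_I AE_I2) auto
  have ge: "0 \<le> Linfty_norm M f" if "f \<in> borel_measurable M" for f :: "'a \<Rightarrow> 'b"
  proof -
    have "esssup M (\<lambda>_. 0 :: ereal) \<le> esssup M (\<lambda>x. ereal (norm (f x)))"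
      by (intro esssup_mono) auto
    then show ?thesis by (simp add: esssup_const[OF M] Linfty_norm_def)
  qed
  have Linf: "in_Linfty M f" if f: "f \<in> borel_measurable M" "bounded (f ` space M)" for f :: "'a \<Rightarrow> 'b"
  proof -
    obtain c where "\<And>x. x \<in> space M \<Longrightarrow> norm (f x) \<le> c"
      using f(2) by (auto simp: bounded_iff)
    from le[OF f(1) this] have "Linfty_norm M f \<le> ereal c" by simp
    then show ?thesis using f(1) by (auto simp: in_Linfty_def)
  qed
  have "(\<lambda>n. Linfty_norm M (\<lambda>x. F n x - g x)) \<longlonglongrightarrow> 0"
  proof (rule order_tendstoI)
    fix a :: ereal assume "a < 0"
    then show "\<forall>\<^sub>F n in sequentially. a < Linfty_norm M (\<lambda>x. F n x - g x)"
      using ge[of "\<lambda>x. F n x - g x" for n] F g by (intro always_eventually allI) (auto intro: less_le_trans)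
  next
    fix a :: ereal assume "0 < a"
    then obtain e where e: "0 < ereal e" "ereal e < a"
      using ereal_dense2 by blast
    then have "\<forall>\<^sub>F n in sequentially. \<forall>x\<in>space M. dist (F n x) (g x) < e"
      using uniform_limitD[OF lim, of e] by simp
    then show "\<forall>\<^sub>F n in sequentially. Linfty_norm M (\<lambda>x. F n x - g x) < a"
    proof eventually_elim
      case (elim n)
      have "Linfty_norm M (\<lambda>x. F n x - g x) \<le> ereal e"
        using elim F g by (intro le) (auto simp: dist_norm less_imp_le)
      then show ?case using e(2) by (rule le_less_trans)
    qed
  qed
  then show ?thesis
    unfolding tendsto_Linfty_def using Linf F g by blast
qed

theorem theorem4p2:
  fixes H :: op_joint and \<beta> \<rho>0 :: op_sys and \<Gamma> :: real
  assumes "\<rho>0 \<in> density_matrices" and "\<beta> \<in> density_matrices"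
    and "\<Gamma> > 0" and "hermitian H"
  shows "\<exists>\<phi> :: real \<Rightarrow> op_sys.
      (\<forall>t\<in>{0..1}. \<phi> t \<in> density_matrices)
      \<and> solves_memory_eq H \<beta> \<Gamma> \<rho>0 \<phi>
      \<and> (\<forall>\<psi>. (\<forall>t\<in>{0..1}. \<psi> t \<in> density_matrices) \<and> solves_memory_eq H \<beta> \<Gamma> \<rho>0 \<psi>
            \<longrightarrow> (\<forall>t\<in>{0..1}. \<psi> t = \<phi> t))
      \<and> tendsto_Linfty (lebesgue_on {0..1})
          (\<lambda>n t. collision_state H \<beta> \<Gamma> \<rho>0 n (nat \<lfloor>real n * t\<rfloor>)) \<phi>"
proof -
  have tr: "trace \<beta> = 1" using assms(2) by (simp add: density_iff)
  interpret memory_kernel "evol H \<beta>" \<Gamma> density_matrices \<rho>0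
    by (rule memory_kernel.intro) (simp_all add: assms linear_evol continuous_evol evol_0[OF tr] closed_density
        convex_density bounded_density evol_density)
  have sol: "solves_memory_eq H \<beta> \<Gamma> \<rho>0 f \<longleftrightarrow> solution f" for f
    by (simp add: solves_memory_eq_def solution_def picard_def kern_def[abs_def])
  obtain \<phi> where \<phi>: "solution \<phi>" "continuous_on {0..1} \<phi>" "\<And>t. t \<in> {0..1} \<Longrightarrow> \<phi> t \<in> density_matrices"
    using solution_exists by blast
  let ?F = "\<lambda>n t. collision_state H \<beta> \<Gamma> \<rho>0 n (nat \<lfloor>real n * t\<rfloor>)"
  have "tendsto_Linfty (lebesgue_on {0..1}) ?F \<phi>"
  proof (rule tendsto_Linfty_uniform_limit)
    show "emeasure (lebesgue_on {0..1::real}) (space (lebesgue_on {0..1})) \<noteq> 0"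
      by (simp add: emeasure_restrict_space)
    show "?F n \<in> borel_measurable (lebesgue_on {0..1})" for n
    proof -
      have "?F n \<in> borel_measurable lborel" by measurable
      then show ?thesis
        by (intro measurable_restrict_space1 measurable_completion)
    qed
    show "bounded (?F n ` space (lebesgue_on {0..1}))" for n
    proof (rule finite_imp_bounded, rule finite_subset)
      show "?F n ` space (lebesgue_on {0..1}) \<subseteq> collision_state H \<beta> \<Gamma> \<rho>0 n ` {..n}"
      proof (clarsimp intro!: imageI)
        fix t :: real assume "0 \<le> t" "t \<le> 1"
        then have "real n * t \<le> real n" by (simp add: mult_left_le)
        then show "nat \<lfloor>real n * t\<rfloor> \<le> n" by linarith
      qed
    qed simp
    show "\<phi> \<in> borel_measurable (lebesgue_on {0..1})"
      by (rule continuous_imp_measurable_on_sets_lebesgue[OF \<phi>(2)]) simp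
    show "bounded (\<phi> ` space (lebesgue_on {0..1}))"
      by (rule bounded_subset[OF bounded_density]) (auto intro: \<phi>(3))
    show "uniform_limit (space (lebesgue_on {0..1})) ?F \<phi> sequentially"
      using scheme_converges[OF \<phi>(1,2) collision_state_rec[OF assms(4) tr]] by simp
  qed
  then show ?thesis
    using \<phi> solution_unique by (intro exI[of _ \<phi>]) (auto simp: sol)
qed

end
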